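(* Let $L$ be a flat linear transport over the $n$-dimensional manifold $M$. For each $x\in M$ let $\{E_i(x)\}$ and $\{E^i(x)\}$, $i=1,\dots,n$, be dual bases of $T_x(M)$ and $T_x^*(M)$, and let the numbers $H^{i}{}_{j}(y,x)$ and $H_{i}{}^{j}(y,x)$ be defined by $$L_{x\to y}(E_j(x))=H^{i}{}_{j}(y,x)E_i(y),\qquad L_{x\to y}(E^j(x))=H_{i}{}^{j}(y,x)E^i(y).$$ If $x,y\in M$ and $$T=T^{i_1\ldots i_p}_{j_1\ldots j_q}\,E_{i_1}(x)\otimes\cdots\otimes E_{i_p}(x)\otimes E^{j_1}(x)\otimes\cdots\otimes E^{j_q}(x)\in T^{p,q}_x(M),$$ then $$L_{x\to y}(T)=\Bigl(\prod_{a=1}^{p}H^{k_a}{}_{i_a}(y,x)\Bigr)\Bigl(\prod_{b=1}^{q}H_{l_b}{}^{j_b}(y,x)\Bigr)T^{i_1\ldots i_p}_{j_1\ldots j_q}\,E_{k_1}(y)\otimes\cdots\otimes E_{k_p}(y)\otimes E^{l_1}(y)\otimes\cdots\otimes E^{l_q}(y).$$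
   Context: Repeated indices are summed from $1$ to $n=\dim M$. $T^{p,q}_x(M)$ is the space of tensors of type $(p,q)$ at $x$ (with $T^{0,0}_x(M)=\mathbb{R}$, $T^{1,0}_x(M)=T_x(M)$, $T^{0,1}_x(M)=T_x^*(M)$). A flat linear transport (of tensors) over a real differentiable manifold $M$ is a map $L:(x,y)\mapsto L_{x\to y}$, $x,y\in M$, where $L_{x\to y}$ maps tensors at $x$ to tensors at $y$, such that for all $x,y,z\in M$ and all types: (i) $L_{x\to y}(T^{p,q}_x(M))\subseteq T^{p,q}_y(M)$; (ii) $L_{x\to y}(\lambda A+\mu A')=\lambda L_{x\to y}A+\mu L_{x\to y}A'$ for $\lambda,\mu\in\mathbb{R}$, $A,A'\in T^{p,q}_x(M)$; (iii) $L_{x\to y}(A_1\otimes A_2)=(L_{x\to y}A_1)\otimes(L_{x\to y}A_2)$ for tensors $A_1,A_2$ at $x$ of arbitrary types; (iv) $L_{x\to y}\circ C=C\circ L_{x\to y}$ for every contraction operator $C$; (v) $L_{y\to z}\circ L_{x\to y}=L_{x\to z}$; (vi) $L_{x\to x}=\mathrm{id}$. *)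

theory Defs
  imports "HOL-Analysis.Analysis" "HOL-Library.Function_Algebras"
begin

section \<open>Pointwise real vector space structure on functions\<close>

text \<open>Tangent vectors, covectors and tensors are all encoded as functions, with pointwise
  operations.\<close>

instantiation "fun" :: (type, real_vector) real_vector
begin

definition scaleR_fun_def: "scaleR r f = (\<lambda>x. r *\<^sub>R f x)"

instance
  by standard (simp_all add: scaleR_fun_def plus_fun_def fun_eq_iff scaleR_add_right scaleR_add_left)

end

section \<open>Differentiable manifolds and tangent spaces\<close>

text \<open>A chart is a pair of its domain and its coordinate map; the values of the coordinate map
  outside the domain are irrelevant. The model space has dimension \<open>n = CARD('n)\<close>.\<close>

type_synonym ('m, 'n) chart = "'m set \<times> ('m \<Rightarrow> real ^ 'n)"

definition is_chart :: "'m topology \<Rightarrow> ('m, 'n::finite) chart \<Rightarrow> bool" where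
  "is_chart M c \<longleftrightarrow> openin M (fst c) \<and> open (snd c ` fst c) \<and>
     homeomorphic_map (subtopology M (fst c)) (top_of_set (snd c ` fst c)) (snd c)"

definition transition ::
    "('m, 'n::finite) chart \<Rightarrow> ('m, 'n) chart \<Rightarrow> real ^ 'n \<Rightarrow> real ^ 'n" where
  "transition c d = snd d \<circ> inv_into (fst c) (snd c)"

definition C1_on :: "('a::real_normed_vector \<Rightarrow> 'b::real_normed_vector) \<Rightarrow> 'a set \<Rightarrow> bool" where
  "C1_on f S \<longleftrightarrow> (\<exists>f' :: 'a \<Rightarrow> 'a \<Rightarrow>\<^sub>L 'b.
     (\<forall>z\<in>S. (f has_derivative blinfun_apply (f' z)) (at z)) \<and> continuous_on S f')"

text \<open>Only class \<open>C\<^sup>1\<close> is demanded, which is what tangent spaces need; in particular every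
  manifold of class \<open>C\<^sup>r\<close>, \<open>1 \<le> r \<le> \<infinity>\<close>, is covered. The atlas is not required to be maximal,
  and no countability axiom is imposed.\<close>

definition differentiable_manifold :: "'m topology \<Rightarrow> ('m, 'n::finite) chart set \<Rightarrow> bool" where
  "differentiable_manifold M \<A> \<longleftrightarrow>
     Hausdorff_space M \<and>
     (\<forall>c\<in>\<A>. is_chart M c) \<and>
     (\<Union>c\<in>\<A>. fst c) = topspace M \<and>
     (\<forall>c\<in>\<A>. \<forall>d\<in>\<A>. C1_on (transition c d) (snd c ` (fst c \<inter> fst d)))"

text \<open>A tangent vector at \<open>x\<close> assigns to every chart around \<open>x\<close> a tuple of components, and the
  components with respect to two charts are related by the Jacobian of the change of coordinates.
  On all other charts it is \<open>0\<close> by convention, so that HOL equality is equality of tangent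
  vectors.\<close>

type_synonym ('m, 'n) tvec = "('m, 'n) chart \<Rightarrow> real ^ 'n"

definition tangent_space :: "('m, 'n::finite) chart set \<Rightarrow> 'm \<Rightarrow> ('m, 'n) tvec set" where
  "tangent_space \<A> x = {v.
     (\<forall>c. \<not> (c \<in> \<A> \<and> x \<in> fst c) \<longrightarrow> v c = 0) \<and>
     (\<forall>c\<in>\<A>. \<forall>d\<in>\<A>. x \<in> fst c \<longrightarrow> x \<in> fst d \<longrightarrow>
        v d = frechet_derivative (transition c d) (at (snd c x)) (v c))}"

text \<open>Covectors are linear functionals on the tangent space, extended by \<open>0\<close> outside it.\<close>

type_synonym ('m, 'n) covec = "('m, 'n) tvec \<Rightarrow> real"

definition cotangent_space :: "('m, 'n::finite) chart set \<Rightarrow> 'm \<Rightarrow> ('m, 'n) covec set" where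
  "cotangent_space \<A> x = {\<omega>.
     (\<forall>v. v \<notin> tangent_space \<A> x \<longrightarrow> \<omega> v = 0) \<and>
     (\<forall>v\<in>tangent_space \<A> x. \<forall>w\<in>tangent_space \<A> x. \<forall>a b.
        \<omega> (a *\<^sub>R v + b *\<^sub>R w) = a * \<omega> v + b * \<omega> w)}"

definition is_basis :: "'v::real_vector set \<Rightarrow> ('n \<Rightarrow> 'v) \<Rightarrow> bool" where
  "is_basis V B \<longleftrightarrow> inj B \<and> independent (range B) \<and> span (range B) = V"

definition dual_bases ::
    "('m, 'n::finite) chart set \<Rightarrow> 'm \<Rightarrow> ('n \<Rightarrow> ('m, 'n) tvec) \<Rightarrow> ('n \<Rightarrow> ('m, 'n) covec) \<Rightarrow> bool" where
  "dual_bases \<A> x E F \<longleftrightarrow>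
     is_basis (tangent_space \<A> x) E \<and> is_basis (cotangent_space \<A> x) F \<and>
     (\<forall>i j. F i (E j) = (if i = j then 1 else 0))"

section \<open>Tensors\<close>

text \<open>A tensor of type \<open>(p, q)\<close> at \<open>x\<close> is a multilinear function of \<open>p\<close> covectors and \<open>q\<close> vectors
  at \<open>x\<close>; the arguments are passed as two lists, and the function is extended by \<open>0\<close> to all
  other pairs of lists.\<close>

type_synonym ('m, 'n) tensor = "('m, 'n) covec list \<Rightarrow> ('m, 'n) tvec list \<Rightarrow> real"

definition tensor_args ::
    "('m, 'n::finite) chart set \<Rightarrow> 'm \<Rightarrow> nat \<Rightarrow> nat \<Rightarrow>
       (('m, 'n) covec list \<times> ('m, 'n) tvec list) set" where
  "tensor_args \<A> x p q = {(\<omega>s, vs).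
     length \<omega>s = p \<and> set \<omega>s \<subseteq> cotangent_space \<A> x \<and>
     length vs = q \<and> set vs \<subseteq> tangent_space \<A> x}"

definition tensors :: "('m, 'n::finite) chart set \<Rightarrow> 'm \<Rightarrow> nat \<Rightarrow> nat \<Rightarrow> ('m, 'n) tensor set" where
  "tensors \<A> x p q = {T.
     (\<forall>\<omega>s vs. (\<omega>s, vs) \<notin> tensor_args \<A> x p q \<longrightarrow> T \<omega>s vs = 0) \<and>
     (\<forall>(\<omega>s, vs)\<in>tensor_args \<A> x p q.
        (\<forall>r<p. \<forall>\<alpha>\<in>cotangent_space \<A> x. \<forall>\<beta>\<in>cotangent_space \<A> x. \<forall>a b.
           T (\<omega>s[r := a *\<^sub>R \<alpha> + b *\<^sub>R \<beta>]) vs = a * T (\<omega>s[r := \<alpha>]) vs + b * T (\<omega>s[r := \<beta>]) vs) \<and>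
        (\<forall>s<q. \<forall>u\<in>tangent_space \<A> x. \<forall>w\<in>tangent_space \<A> x. \<forall>a b.
           T \<omega>s (vs[s := a *\<^sub>R u + b *\<^sub>R w]) = a * T \<omega>s (vs[s := u]) + b * T \<omega>s (vs[s := w])))}"

text \<open>The canonical identifications of scalars, vectors and covectors at \<open>x\<close> with tensors of type
  \<open>(0, 0)\<close>, \<open>(1, 0)\<close> and \<open>(0, 1)\<close>. A vector acts on covectors by evaluation.\<close>

definition scalar_tensor :: "real \<Rightarrow> ('m, 'n) tensor" where
  "scalar_tensor r = (\<lambda>\<omega>s vs. if \<omega>s = [] \<and> vs = [] then r else 0)"

definition vector_tensor ::
    "('m, 'n::finite) chart set \<Rightarrow> 'm \<Rightarrow> ('m, 'n) tvec \<Rightarrow> ('m, 'n) tensor" where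
  "vector_tensor \<A> x v = (\<lambda>\<omega>s vs.
     if (\<omega>s, vs) \<in> tensor_args \<A> x 1 0 then (hd \<omega>s) v else 0)"

definition covector_tensor ::
    "('m, 'n::finite) chart set \<Rightarrow> 'm \<Rightarrow> ('m, 'n) covec \<Rightarrow> ('m, 'n) tensor" where
  "covector_tensor \<A> x \<omega> = (\<lambda>\<omega>s vs.
     if (\<omega>s, vs) \<in> tensor_args \<A> x 0 1 then \<omega> (hd vs) else 0)"

text \<open>Tensor product of a tensor \<open>A\<close> of type \<open>(p, q)\<close> with a tensor \<open>B\<close> of any type.\<close>

definition tensor_prod ::
    "nat \<Rightarrow> nat \<Rightarrow> ('m, 'n) tensor \<Rightarrow> ('m, 'n) tensor \<Rightarrow> ('m, 'n) tensor" where
  "tensor_prod p q A B = (\<lambda>\<omega>s vs. A (take p \<omega>s) (take q vs) * B (drop p \<omega>s) (drop q vs))"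

text \<open>The product of \<open>vs\<close> and then \<open>\<omega>s\<close>, bracketed to the right; the empty product is the scalar \<open>1\<close>.\<close>

definition tensor_prod_list ::
    "('m, 'n::finite) chart set \<Rightarrow> 'm \<Rightarrow> ('m, 'n) tvec list \<Rightarrow> ('m, 'n) covec list \<Rightarrow>
       ('m, 'n) tensor" where
  "tensor_prod_list \<A> x vs \<omega>s =
     foldr (\<lambda>v. tensor_prod 1 0 (vector_tensor \<A> x v)) vs
       (foldr (\<lambda>\<omega>. tensor_prod 0 1 (covector_tensor \<A> x \<omega>)) \<omega>s (scalar_tensor 1))"

definition insert_at :: "nat \<Rightarrow> 'a \<Rightarrow> 'a list \<Rightarrow> 'a list" where
  "insert_at r y ys = take r ys @ y # drop r ys"

text \<open>Contraction of the \<open>r\<close>-th contravariant with the \<open>s\<close>-th covariant index (counted from \<open>0\<close>).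
  Dual bases exist and the choice is immaterial, see \<open>dual_bases_exist\<close> and \<open>contraction_eq\<close>
  below.\<close>

definition contraction ::
    "('m, 'n::finite) chart set \<Rightarrow> 'm \<Rightarrow> nat \<Rightarrow> nat \<Rightarrow> ('m, 'n) tensor \<Rightarrow> ('m, 'n) tensor" where
  "contraction \<A> x r s T = (\<lambda>\<omega>s vs.
     let (E, F) = (SOME (E, F). dual_bases \<A> x E F)
     in \<Sum>i\<in>UNIV. T (insert_at r (F i) \<omega>s) (insert_at s (E i) vs))"

section \<open>Flat linear transports\<close>

definition flat_linear_transport ::
    "'m topology \<Rightarrow> ('m, 'n::finite) chart set \<Rightarrow>
       ('m \<Rightarrow> 'm \<Rightarrow> ('m, 'n) tensor \<Rightarrow> ('m, 'n) tensor) \<Rightarrow> bool" where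
  "flat_linear_transport M \<A> L \<longleftrightarrow>
     (\<forall>x\<in>topspace M. \<forall>y\<in>topspace M. \<forall>p q. L x y ` tensors \<A> x p q \<subseteq> tensors \<A> y p q) \<and>
     (\<forall>x\<in>topspace M. \<forall>y\<in>topspace M. \<forall>p q. \<forall>A\<in>tensors \<A> x p q. \<forall>A'\<in>tensors \<A> x p q. \<forall>l m.
        L x y (l *\<^sub>R A + m *\<^sub>R A') = l *\<^sub>R L x y A + m *\<^sub>R L x y A') \<and>
     (\<forall>x\<in>topspace M. \<forall>y\<in>topspace M. \<forall>p q p' q'. \<forall>A\<in>tensors \<A> x p q. \<forall>A'\<in>tensors \<A> x p' q'.
        L x y (tensor_prod p q A A') = tensor_prod p q (L x y A) (L x y A')) \<and>
     (\<forall>x\<in>topspace M. \<forall>y\<in>topspace M. \<forall>p q. \<forall>r\<le>p. \<forall>s\<le>q. \<forall>A\<in>tensors \<A> x (Suc p) (Suc q).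
        L x y (contraction \<A> x r s A) = contraction \<A> y r s (L x y A)) \<and>
     (\<forall>x\<in>topspace M. \<forall>y\<in>topspace M. \<forall>z\<in>topspace M. \<forall>p q. \<forall>A\<in>tensors \<A> x p q.
        L y z (L x y A) = L x z A) \<and>
     (\<forall>x\<in>topspace M. \<forall>p q. \<forall>A\<in>tensors \<A> x p q. L x x A = A)"

section \<open>Existence of dual bases and independence of contractions of the basis\<close>

lemma sum_fun_apply: "(\<Sum>i\<in>S. f i) x = (\<Sum>i\<in>S. f i x)"
  by (induction S rule: infinite_finite_induct) auto

lemma is_basis_sum:
  fixes B :: "'n::finite \<Rightarrow> 'v::real_vector"
  assumes "is_basis V B" "v \<in> V"
  obtains a where "v = (\<Sum>i\<in>UNIV. a i *\<^sub>R B i)"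
proof -
  have inj: "inj B" and v: "v \<in> span (range B)"
    using assms unfolding is_basis_def by auto
  from v obtain u where "v = (\<Sum>w\<in>range B. u w *\<^sub>R w)"
    by (auto simp: span_finite)
  then have "v = (\<Sum>i\<in>UNIV. u (B i) *\<^sub>R B i)"
    by (simp add: sum.reindex[OF inj])
  then show thesis by (rule that)
qed

lemma lin_sum:
  fixes \<phi> :: "'v::real_vector \<Rightarrow> real"
  assumes V: "subspace V"
    and lin: "\<And>v w a b. v \<in> V \<Longrightarrow> w \<in> V \<Longrightarrow> \<phi> (a *\<^sub>R v + b *\<^sub>R w) = a * \<phi> v + b * \<phi> w"
    and B: "\<And>i. i \<in> I \<Longrightarrow> B i \<in> V"
  shows "\<phi> (\<Sum>i\<in>I. a i *\<^sub>R B i) = (\<Sum>i\<in>I. a i * \<phi> (B i))"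
  using B
proof (induction I rule: infinite_finite_induct)
  case (insert i I)
  have "(\<Sum>i\<in>I. a i *\<^sub>R B i) \<in> V"
    using V insert by (intro subspace_sum subspace_scale) auto
  then show ?case
    using insert lin[of "B i" "\<Sum>i\<in>I. a i *\<^sub>R B i" "a i" 1] by simp
qed (use lin[of 0 0 0 0] subspace_0[OF V] in auto)

lemma dual_bases_subspace:
  assumes "dual_bases \<A> x E F"
  shows "subspace (tangent_space \<A> x)" "subspace (cotangent_space \<A> x)"
    "E i \<in> tangent_space \<A> x" "F i \<in> cotangent_space \<A> x"
  using assms unfolding dual_bases_def is_basis_def
  by (metis subspace_span, metis subspace_span, metis rangeI span_base, metis rangeI span_base)

lemma cotangent_space_linear:
  assumes "\<omega> \<in> cotangent_space \<A> x" "v \<in> tangent_space \<A> x" "w \<in> tangent_space \<A> x"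
  shows "\<omega> (a *\<^sub>R v + b *\<^sub>R w) = a * \<omega> v + b * \<omega> w"
  using assms unfolding cotangent_space_def by blast

lemma is_basisI:
  fixes B :: "'n::finite \<Rightarrow> 'v::real_vector"
  assumes V: "subspace V" and B: "\<And>i. B i \<in> V"
    and ex: "\<And>v. v \<in> V \<Longrightarrow> \<exists>a. v = (\<Sum>i\<in>UNIV. a i *\<^sub>R B i)"
    and uniq: "\<And>a i. (\<Sum>i\<in>UNIV. a i *\<^sub>R B i) = 0 \<Longrightarrow> a i = 0"
  shows "is_basis V B"
proof -
  have inj: "inj B"
  proof (rule injI, rule ccontr)
    fix i j assume eq: "B i = B j" and ne: "i \<noteq> j"
    define a :: "'n \<Rightarrow> real" where "a k = (if k = i then 1 else 0) - (if k = j then 1 else 0)" for k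
    have "(\<Sum>k\<in>UNIV. a k *\<^sub>R B k) =
        (\<Sum>k\<in>UNIV. (if k = i then B k else 0)) - (\<Sum>k\<in>UNIV. (if k = j then B k else 0))"
      unfolding sum_subtractf[symmetric] a_def by (intro sum.cong) (auto simp: scaleR_left_diff_distrib)
    also have "\<dots> = 0" using eq by simp
    finally have "a i = 0" by (rule uniq)
    then show False using ne by (simp add: a_def)
  qed
  have "independent (range B)"
  proof (rule independent_if_scalars_zero)
    fix u v assume 0: "(\<Sum>v\<in>range B. u v *\<^sub>R v) = 0" and "v \<in> range B"
    then obtain i where v: "v = B i" by blast
    from 0 have "(\<Sum>i\<in>UNIV. u (B i) *\<^sub>R B i) = 0" by (simp add: sum.reindex[OF inj])
    then show "u v = 0" unfolding v by (rule uniq)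
  qed simp
  moreover have "span (range B) = V"
  proof
    show "span (range B) \<subseteq> V" using B V by (intro span_minimal) auto
    show "V \<subseteq> span (range B)"
    proof
      fix v assume "v \<in> V"
      then obtain a where "v = (\<Sum>i\<in>UNIV. a i *\<^sub>R B i)" using ex by blast
      then show "v \<in> span (range B)"
        by (simp add: span_sum span_scale span_base)
    qed
  qed
  ultimately show ?thesis using inj unfolding is_basis_def by blast
qed

lemma chart_image_open:
  assumes "is_chart M c" "is_chart M d"
  shows "open (snd c ` (fst c \<inter> fst d))"
proof -
  have "open_map (subtopology M (fst c)) (top_of_set (snd c ` fst c)) (snd c)"
    using assms homeomorphic_imp_open_map unfolding is_chart_def by blast
  moreover have "openin (subtopology M (fst c)) (fst c \<inter> fst d)"
    using assms unfolding is_chart_def by (auto simp: openin_subtopology)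
  ultimately have "openin (top_of_set (snd c ` fst c)) (snd c ` (fst c \<inter> fst d))"
    unfolding open_map_def by blast
  then show ?thesis using assms unfolding is_chart_def by (simp add: openin_open_eq)
qed

lemma chart_inj: "is_chart M c \<Longrightarrow> inj_on (snd c) (fst c)"
  unfolding is_chart_def homeomorphic_map_def
  by (metis inf.absorb2 openin_subset topspace_subtopology)

lemma transition_apply:
  assumes "is_chart M c" "m \<in> fst c"
  shows "transition c d (snd c m) = snd d m"
  using inv_into_f_f[OF chart_inj[OF assms(1)] assms(2)] by (simp add: transition_def)

lemma jacobian:
  assumes M: "differentiable_manifold M \<A>"
    and c: "c \<in> \<A>" "x \<in> fst c" and d: "d \<in> \<A>" "x \<in> fst d"
  shows "(transition c d has_derivative frechet_derivative (transition c d) (at (snd c x))) (at (snd c x))"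
proof -
  have "C1_on (transition c d) (snd c ` (fst c \<inter> fst d))"
    using M c d unfolding differentiable_manifold_def by blast
  moreover have "snd c x \<in> snd c ` (fst c \<inter> fst d)" using c d by blast
  ultimately have "transition c d differentiable at (snd c x)"
    unfolding C1_on_def differentiable_def by blast
  then show ?thesis by (simp add: frechet_derivative_works)
qed

lemma jacobian_cocycle:
  assumes M: "differentiable_manifold M \<A>"
    and c: "c \<in> \<A>" "x \<in> fst c" and d: "d \<in> \<A>" "x \<in> fst d" and e: "e \<in> \<A>" "x \<in> fst e"
  shows "frechet_derivative (transition d e) (at (snd d x))
      (frechet_derivative (transition c d) (at (snd c x)) h) =
    frechet_derivative (transition c e) (at (snd c x)) h"
proof -
  have ch: "is_chart M c" "is_chart M d"
    using M c d unfolding differentiable_manifold_def by blast+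
  have cd: "transition c d (snd c x) = snd d x" by (rule transition_apply[OF ch(1) c(2)])
  have "(transition d e \<circ> transition c d has_derivative
      frechet_derivative (transition d e) (at (snd d x)) \<circ>
      frechet_derivative (transition c d) (at (snd c x))) (at (snd c x))"
    using diff_chain_at[OF jacobian[OF M c d]] jacobian[OF M d e] cd by simp
  then have "(transition c e has_derivative
      frechet_derivative (transition d e) (at (snd d x)) \<circ>
      frechet_derivative (transition c d) (at (snd c x))) (at (snd c x))"
    by (rule has_derivative_transform_within_open[OF _ chart_image_open[OF ch]])
      (use c d ch in \<open>auto simp: transition_apply\<close>)
  then show ?thesis
    using has_derivative_unique[OF _ jacobian[OF M c e]] by (metis comp_apply)
qed

lemma jacobian_id:
  assumes M: "differentiable_manifold M \<A>" and c: "c \<in> \<A>" "x \<in> fst c"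
  shows "frechet_derivative (transition c c) (at (snd c x)) h = h"
proof -
  have ch: "is_chart M c" using M c unfolding differentiable_manifold_def by blast
  have "((\<lambda>z. z) has_derivative (\<lambda>h. h)) (at (snd c x))" by (rule has_derivative_ident)
  then have "(transition c c has_derivative (\<lambda>h. h)) (at (snd c x))"
    by (rule has_derivative_transform_within_open[OF _ chart_image_open[OF ch ch]])
      (use c ch in \<open>auto simp: transition_apply\<close>)
  then show ?thesis
    using has_derivative_unique[OF _ jacobian[OF M c c]] by metis
qed

lemma subspace_tangent_space:
  assumes M: "differentiable_manifold M \<A>"
  shows "subspace (tangent_space \<A> x)"
proof -
  have lin: "linear (frechet_derivative (transition c d) (at (snd c x)))"
    if "c \<in> \<A>" "x \<in> fst c" "d \<in> \<A>" "x \<in> fst d" for c d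
    using jacobian[OF M that] has_derivative_linear by blast
  have "0 \<in> tangent_space \<A> x"
    unfolding tangent_space_def using linear_0[OF lin] by simp
  moreover have "v + w \<in> tangent_space \<A> x"
    if "v \<in> tangent_space \<A> x" "w \<in> tangent_space \<A> x" for v w
  proof -
    have "(v + w) d = frechet_derivative (transition c d) (at (snd c x)) ((v + w) c)"
      if cd: "c \<in> \<A>" "x \<in> fst c" "d \<in> \<A>" "x \<in> fst d" for c d
    proof -
      have "v d = frechet_derivative (transition c d) (at (snd c x)) (v c)"
        "w d = frechet_derivative (transition c d) (at (snd c x)) (w c)"
        using \<open>v \<in> _\<close> \<open>w \<in> _\<close> cd unfolding tangent_space_def by blast+
      then show ?thesis by (metis linear_add[OF lin[OF cd]] plus_fun_apply)
    qed
    moreover have "(v + w) c = 0" if "\<not> (c \<in> \<A> \<and> x \<in> fst c)" for c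
    proof -
      have "v c = 0" "w c = 0"
        using \<open>v \<in> _\<close> \<open>w \<in> _\<close> that unfolding tangent_space_def by blast+
      then show ?thesis by simp
    qed
    ultimately show ?thesis unfolding tangent_space_def by blast
  qed
  moreover have "r *\<^sub>R v \<in> tangent_space \<A> x" if "v \<in> tangent_space \<A> x" for r v
  proof -
    have "(r *\<^sub>R v) d = frechet_derivative (transition c d) (at (snd c x)) ((r *\<^sub>R v) c)"
      if cd: "c \<in> \<A>" "x \<in> fst c" "d \<in> \<A>" "x \<in> fst d" for c d
    proof -
      have "v d = frechet_derivative (transition c d) (at (snd c x)) (v c)"
        using \<open>v \<in> _\<close> cd unfolding tangent_space_def by blast
      then show ?thesis unfolding scaleR_fun_def by (metis linear_scale[OF lin[OF cd]])
    qed
    moreover have "(r *\<^sub>R v) c = 0" if "\<not> (c \<in> \<A> \<and> x \<in> fst c)" for c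
    proof -
      have "v c = 0" using \<open>v \<in> _\<close> that unfolding tangent_space_def by blast
      then show ?thesis by (simp add: scaleR_fun_def)
    qed
    ultimately show ?thesis unfolding tangent_space_def by blast
  qed
  ultimately show ?thesis unfolding subspace_def by blast
qed

lemma subspace_cotangent_space: "subspace (cotangent_space \<A> x)"
  unfolding subspace_def cotangent_space_def
  by (auto simp: scaleR_fun_def algebra_simps)

lemma dual_bases_exist:
  fixes \<A> :: "('m, 'n::finite) chart set"
  assumes M: "differentiable_manifold M \<A>" and x: "x \<in> topspace M"
  shows "\<exists>E F. dual_bases \<A> x E F"
proof -
  obtain c where c: "c \<in> \<A>" "x \<in> fst c"
    using M x unfolding differentiable_manifold_def by blast
  define J where "J d = frechet_derivative (transition c d) (at (snd c x))" for d
  define E :: "'n \<Rightarrow> ('m, 'n) tvec" where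
    "E i = (\<lambda>d. if d \<in> \<A> \<and> x \<in> fst d then J d (axis i 1) else 0)" for i
  define F :: "'n \<Rightarrow> ('m, 'n) covec" where
    "F i = (\<lambda>v. if v \<in> tangent_space \<A> x then v c $ i else 0)" for i
  note sT = subspace_tangent_space[OF M, of x] and sC = subspace_cotangent_space[of \<A> x]
  have E: "E i \<in> tangent_space \<A> x" for i
    unfolding tangent_space_def E_def J_def by (auto simp: jacobian_cocycle[OF M c])
  have Ec: "E i c = axis i 1" for i
    using c by (simp add: E_def J_def jacobian_id[OF M])
  have F: "F i \<in> cotangent_space \<A> x" for i
  proof -
    have "a *\<^sub>R v + b *\<^sub>R w \<in> tangent_space \<A> x"
      if "v \<in> tangent_space \<A> x" "w \<in> tangent_space \<A> x" for v w and a b :: real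
      using sT that by (simp add: subspace_add subspace_scale)
    moreover have "(a *\<^sub>R v + b *\<^sub>R w) c $ i = a * v c $ i + b * w c $ i"
      for v w :: "('m, 'n) tvec" and a b :: real
      by (simp add: scaleR_fun_def)
    ultimately show ?thesis unfolding cotangent_space_def F_def by simp
  qed
  have FE: "F i (E j) = (if i = j then 1 else 0)" for i j
    by (simp add: F_def E Ec axis_def)
  have expE: "v = (\<Sum>i\<in>UNIV. F i v *\<^sub>R E i)" if v: "v \<in> tangent_space \<A> x" for v
  proof
    fix d
    show "v d = (\<Sum>i\<in>UNIV. F i v *\<^sub>R E i) d"
    proof (cases "d \<in> \<A> \<and> x \<in> fst d")
      case True
      then have lin: "linear (J d)"
        unfolding J_def using jacobian[OF M c] has_derivative_linear by blast
      have "v d = J d (v c)" using v c True unfolding tangent_space_def J_def by blast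
      also have "v c = (\<Sum>i\<in>UNIV. (v c $ i) *\<^sub>R axis i 1)"
        using basis_expansion[of "v c"] by (simp add: scalar_mult_eq_scaleR)
      also have "J d \<dots> = (\<Sum>i\<in>UNIV. (v c $ i) *\<^sub>R J d (axis i 1))"
        by (simp add: linear_sum[OF lin] linear_scale[OF lin])
      finally show ?thesis using True v by (simp add: sum_fun_apply scaleR_fun_def E_def F_def)
    next
      case False
      then have "v d = 0" using v unfolding tangent_space_def by blast
      moreover have "E i d = 0" for i using False unfolding E_def by auto
      ultimately show ?thesis by (simp add: sum_fun_apply scaleR_fun_def)
    qed
  qed
  have Fsum: "F j (\<Sum>i\<in>UNIV. a i *\<^sub>R E i) = a j" for a j
  proof -
    have "F j (\<Sum>i\<in>UNIV. a i *\<^sub>R E i) = (\<Sum>i\<in>UNIV. a i * F j (E i))"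
      by (rule lin_sum[where \<phi> = "F j", OF sT cotangent_space_linear[OF F]]) (simp_all add: E)
    also have "\<dots> = (\<Sum>i\<in>UNIV. if j = i then a i else 0)"
      by (intro sum.cong) (auto simp: FE)
    finally show ?thesis by simp
  qed
  have sumE: "(\<Sum>i\<in>UNIV. a i *\<^sub>R F i) (E j) = a j" for a j
  proof -
    have "(\<Sum>i\<in>UNIV. a i *\<^sub>R F i) (E j) = (\<Sum>i\<in>UNIV. if i = j then a i else 0)"
      unfolding sum_fun_apply scaleR_fun_def by (intro sum.cong) (auto simp: FE)
    then show ?thesis by simp
  qed
  have expF: "\<omega> = (\<Sum>i\<in>UNIV. \<omega> (E i) *\<^sub>R F i)" if \<omega>: "\<omega> \<in> cotangent_space \<A> x" for \<omega>
  proof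
    fix v
    show "\<omega> v = (\<Sum>i\<in>UNIV. \<omega> (E i) *\<^sub>R F i) v"
    proof (cases "v \<in> tangent_space \<A> x")
      case True
      have "\<omega> v = \<omega> (\<Sum>i\<in>UNIV. F i v *\<^sub>R E i)" using expE[OF True] by simp
      also have "\<dots> = (\<Sum>i\<in>UNIV. F i v * \<omega> (E i))"
        by (rule lin_sum[where \<phi> = \<omega>, OF sT cotangent_space_linear[OF \<omega>]]) (simp_all add: E)
      finally show ?thesis by (simp add: sum_fun_apply scaleR_fun_def mult.commute)
    next
      case False
      then have "\<omega> v = 0" using \<omega> unfolding cotangent_space_def by blast
      with False show ?thesis by (simp add: sum_fun_apply scaleR_fun_def F_def)
    qed
  qed
  have F0: "F j 0 = 0" for j
    by (simp add: F_def)
  have "is_basis (tangent_space \<A> x) E"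
  proof (rule is_basisI[OF sT E])
    show "\<exists>a. v = (\<Sum>i\<in>UNIV. a i *\<^sub>R E i)" if "v \<in> tangent_space \<A> x" for v
      by (rule exI[of _ "\<lambda>i. F i v"]) (rule expE[OF that])
    show "a i = 0" if "(\<Sum>i\<in>UNIV. a i *\<^sub>R E i) = 0" for a i
      using Fsum[of i a] F0 that by simp
  qed
  moreover have "is_basis (cotangent_space \<A> x) F"
  proof (rule is_basisI[OF sC F])
    show "\<exists>a. \<omega> = (\<Sum>i\<in>UNIV. a i *\<^sub>R F i)" if "\<omega> \<in> cotangent_space \<A> x" for \<omega>
      by (rule exI[of _ "\<lambda>i. \<omega> (E i)"]) (rule expF[OF that])
    show "a i = 0" if "(\<Sum>i\<in>UNIV. a i *\<^sub>R F i) = 0" for a i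
      using sumE[of a i] that by simp
  qed
  ultimately show ?thesis using FE unfolding dual_bases_def by blast
qed

lemma dual_bases_expand_tangent:
  fixes E :: "'n::finite \<Rightarrow> ('m, 'n) tvec"
  assumes db: "dual_bases \<A> x E F" and v: "v \<in> tangent_space \<A> x"
  shows "v = (\<Sum>i\<in>UNIV. F i v *\<^sub>R E i)"
proof -
  from db have "is_basis (tangent_space \<A> x) E" unfolding dual_bases_def by blast
  then obtain a where a: "v = (\<Sum>i\<in>UNIV. a i *\<^sub>R E i)" using v by (rule is_basis_sum)
  have "F j v = a j" for j
  proof -
    have "F j v = (\<Sum>i\<in>UNIV. a i * F j (E i))"
      unfolding a
      by (rule lin_sum[where \<phi> = "F j", OF dual_bases_subspace(1)[OF db]
            cotangent_space_linear[OF dual_bases_subspace(4)[OF db]]])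
        (simp_all add: dual_bases_subspace[OF db])
    also have "\<dots> = (\<Sum>i\<in>UNIV. if j = i then a i else 0)"
      using db unfolding dual_bases_def by (intro sum.cong) auto
    finally show ?thesis by simp
  qed
  then show ?thesis using a by simp
qed

lemma dual_bases_expand_cotangent:
  fixes E :: "'n::finite \<Rightarrow> ('m, 'n) tvec"
  assumes db: "dual_bases \<A> x E F" and \<omega>: "\<omega> \<in> cotangent_space \<A> x"
  shows "\<omega> = (\<Sum>i\<in>UNIV. \<omega> (E i) *\<^sub>R F i)"
proof -
  from db have "is_basis (cotangent_space \<A> x) F" unfolding dual_bases_def by blast
  then obtain a where a: "\<omega> = (\<Sum>i\<in>UNIV. a i *\<^sub>R F i)" using \<omega> by (rule is_basis_sum)
  have "\<omega> (E j) = a j" for j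
  proof -
    have "\<omega> (E j) = (\<Sum>i\<in>UNIV. a i * F i (E j))"
      unfolding a by (simp add: sum_fun_apply scaleR_fun_def)
    also have "\<dots> = (\<Sum>i\<in>UNIV. if i = j then a i else 0)"
      using db unfolding dual_bases_def by (intro sum.cong) auto
    finally show ?thesis by simp
  qed
  then show ?thesis using a by simp
qed

lemma insert_at_update:
  assumes "r \<le> length ys"
  shows "(insert_at r z ys)[r := y] = insert_at r y ys"
  using assms unfolding insert_at_def by (simp add: list_update_append)

lemma insert_at_args:
  assumes "(\<omega>s, vs) \<in> tensor_args \<A> x p q" "r \<le> p" "s \<le> q"
    "\<alpha> \<in> cotangent_space \<A> x" "u \<in> tangent_space \<A> x"
  shows "(insert_at r \<alpha> \<omega>s, insert_at s u vs) \<in> tensor_args \<A> x (Suc p) (Suc q)"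
proof -
  have "set (insert_at r \<alpha> \<omega>s) \<subseteq> insert \<alpha> (set \<omega>s)" "set (insert_at s u vs) \<subseteq> insert u (set vs)"
    unfolding insert_at_def using set_take_subset set_drop_subset by fastforce+
  then show ?thesis using assms unfolding tensor_args_def
    by (auto simp: insert_at_def)
qed

lemma trace_dual_bases:
  fixes E E' :: "'n::finite \<Rightarrow> ('m, 'n) tvec"
  assumes db: "dual_bases \<A> x E F" and db': "dual_bases \<A> x E' F'"
    and l1: "\<And>\<alpha> \<beta> u a b. \<alpha> \<in> cotangent_space \<A> x \<Longrightarrow> \<beta> \<in> cotangent_space \<A> x \<Longrightarrow>
      u \<in> tangent_space \<A> x \<Longrightarrow> B (a *\<^sub>R \<alpha> + b *\<^sub>R \<beta>) u = a * B \<alpha> u + b * B \<beta> u"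
    and l2: "\<And>\<alpha> u w a b. \<alpha> \<in> cotangent_space \<A> x \<Longrightarrow> u \<in> tangent_space \<A> x \<Longrightarrow>
      w \<in> tangent_space \<A> x \<Longrightarrow> B \<alpha> (a *\<^sub>R u + b *\<^sub>R w) = a * B \<alpha> u + b * B \<alpha> w"
  shows "(\<Sum>i\<in>UNIV. B (F i) (E i)) = (\<Sum>i\<in>UNIV. B (F' i) (E' i))"
proof -
  note s = dual_bases_subspace[OF db] and s' = dual_bases_subspace[OF db']
  have "B (F i) (E i) = (\<Sum>j\<in>UNIV. F i (E' j) * B (F' j) (E i))" for i
  proof -
    have "B (F i) (E i) = B (\<Sum>j\<in>UNIV. F i (E' j) *\<^sub>R F' j) (E i)"
      using dual_bases_expand_cotangent[OF db' s(4)] by metis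
    also have "\<dots> = (\<Sum>j\<in>UNIV. F i (E' j) * B (F' j) (E i))"
      by (rule lin_sum[where \<phi> = "\<lambda>\<omega>. B \<omega> (E i)", OF s(2) l1[OF _ _ s(3)]])
        (simp_all add: s')
    finally show ?thesis .
  qed
  moreover have "B (F' j) (E' j) = (\<Sum>i\<in>UNIV. F i (E' j) * B (F' j) (E i))" for j
  proof -
    have "B (F' j) (E' j) = B (F' j) (\<Sum>i\<in>UNIV. F i (E' j) *\<^sub>R E i)"
      using dual_bases_expand_tangent[OF db s'(3)] by metis
    also have "\<dots> = (\<Sum>i\<in>UNIV. F i (E' j) * B (F' j) (E i))"
      by (rule lin_sum[where \<phi> = "B (F' j)", OF s(1) l2[OF s'(4)]])
        (simp_all add: s)
    finally show ?thesis .
  qed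
  ultimately show ?thesis by (simp add: sum.swap[of "\<lambda>i j. F i (E' j) * B (F' j) (E i)"])
qed

lemma contraction_eq:
  fixes E :: "'n::finite \<Rightarrow> ('m, 'n) tvec"
  assumes db: "dual_bases \<A> x E F" and T: "T \<in> tensors \<A> x (Suc p) (Suc q)"
    and rs: "r \<le> p" "s \<le> q" and args: "(\<omega>s, vs) \<in> tensor_args \<A> x p q"
  shows "contraction \<A> x r s T \<omega>s vs =
    (\<Sum>i\<in>UNIV. T (insert_at r (F i) \<omega>s) (insert_at s (E i) vs))"
proof -
  define P where "P = (SOME (E, F). dual_bases \<A> x E F)"
  have "case P of (E, F) \<Rightarrow> dual_bases \<A> x E F"
    unfolding P_def by (rule someI[of _ "(E, F)"]) (simp add: db)
  then obtain E' F' where P: "P = (E', F')" and db': "dual_bases \<A> x E' F'"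
    by (cases P) auto
  define B where "B \<alpha> u = T (insert_at r \<alpha> \<omega>s) (insert_at s u vs)" for \<alpha> u
  have len: "r \<le> length \<omega>s" "s \<le> length vs"
    using args rs unfolding tensor_args_def by auto
  have "contraction \<A> x r s T \<omega>s vs = (\<Sum>i\<in>UNIV. B (F' i) (E' i))"
    unfolding contraction_def B_def P_def[symmetric] P by simp
  also have "\<dots> = (\<Sum>i\<in>UNIV. B (F i) (E i))"
  proof (rule trace_dual_bases[OF db' db])
    fix \<alpha> \<beta> u and a b :: real
    assume A: "\<alpha> \<in> cotangent_space \<A> x" "\<beta> \<in> cotangent_space \<A> x" "u \<in> tangent_space \<A> x"
    have "r < Suc p" using rs by simp
    then have "T ((insert_at r \<alpha> \<omega>s)[r := a *\<^sub>R \<alpha> + b *\<^sub>R \<beta>]) (insert_at s u vs) =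
      a * T ((insert_at r \<alpha> \<omega>s)[r := \<alpha>]) (insert_at s u vs) +
      b * T ((insert_at r \<alpha> \<omega>s)[r := \<beta>]) (insert_at s u vs)"
      using T insert_at_args[OF args rs A(1,3)] A unfolding tensors_def by blast
    then show "B (a *\<^sub>R \<alpha> + b *\<^sub>R \<beta>) u = a * B \<alpha> u + b * B \<beta> u"
      by (simp add: B_def insert_at_update len)
  next
    fix \<alpha> u w and a b :: real
    assume A: "\<alpha> \<in> cotangent_space \<A> x" "u \<in> tangent_space \<A> x" "w \<in> tangent_space \<A> x"
    have "s < Suc q" using rs by simp
    then have "T (insert_at r \<alpha> \<omega>s) ((insert_at s u vs)[s := a *\<^sub>R u + b *\<^sub>R w]) =
      a * T (insert_at r \<alpha> \<omega>s) ((insert_at s u vs)[s := u]) +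
      b * T (insert_at r \<alpha> \<omega>s) ((insert_at s u vs)[s := w])"
      using T insert_at_args[OF args rs A(1,2)] A unfolding tensors_def by blast
    then show "B \<alpha> (a *\<^sub>R u + b *\<^sub>R w) = a * B \<alpha> u + b * B \<alpha> w"
      by (simp add: B_def insert_at_update len)
  qed
  finally show ?thesis by (simp add: B_def)
qed

end

theory Submission
  imports Defs
begin

text \<open>A transport that respects linear combinations and tensor products is determined by its
  values on scalars, vectors and covectors. Apply it to the expansion of \<open>T\<close>: linearity takes it
  inside the sum, and on each basis tensor compatibility with tensor products
  (\<open>transport_foldr_tensor_prod\<close>) takes it to the single factors. There it replaces each basis
  vector and covector by its expansion in the basis at \<open>y\<close>, and multiplying these expansions out
  (\<open>foldr_tensor_prod_sum\<close>) yields the products of the matrix entries.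

  What remains are the scalars, because an iterated product ends in the scalar \<open>1\<close>. As
  \<open>1 \<otimes> 1 = 1\<close>, the transport sends \<open>1\<close> to an idempotent scalar, and as transporting back recovers
  \<open>1\<close>, this scalar is not \<open>0\<close>; hence it is \<open>1\<close> (\<open>transport_scalar_one\<close>).\<close>

section \<open>Tensor spaces\<close>

lemma subspace_tensors: "subspace (tensors \<A> x p q)"
proof (rule subspaceI)
  show "0 \<in> tensors \<A> x p q"
    unfolding tensors_def by auto
  show "A + B \<in> tensors \<A> x p q" if "A \<in> tensors \<A> x p q" "B \<in> tensors \<A> x p q" for A B
    using that unfolding tensors_def by (clarsimp simp: algebra_simps split_beta)
  show "c *\<^sub>R A \<in> tensors \<A> x p q" if "A \<in> tensors \<A> x p q" for c A
    using that unfolding tensors_def by (clarsimp simp: scaleR_fun_def algebra_simps split_beta)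
qed

lemma scalar_tensor_in_tensors: "scalar_tensor r \<in> tensors \<A> x 0 0"
  unfolding tensors_def tensor_args_def scalar_tensor_def by auto

lemma scalar_tensor_zero: "scalar_tensor 0 = 0"
  by (simp add: scalar_tensor_def fun_eq_iff)

lemma scalar_tensor_eq_iff:
  "(scalar_tensor a :: ('m, 'n) tensor) = scalar_tensor b \<longleftrightarrow> a = b"
proof
  assume "(scalar_tensor a :: ('m, 'n) tensor) = scalar_tensor b"
  from fun_cong[OF fun_cong[OF this], of "[]" "[]"] show "a = b"
    by (simp add: scalar_tensor_def)
qed simp

lemma tensors_scalarE:
  assumes "A \<in> tensors \<A> x 0 0"
  obtains c where "A = scalar_tensor c"
proof
  show "A = scalar_tensor (A [] [])"
    using assms unfolding tensors_def tensor_args_def scalar_tensor_def by (auto simp: fun_eq_iff)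
qed

lemma vector_tensor_in_tensors:
  assumes "subspace (cotangent_space \<A> x)"
  shows "vector_tensor \<A> x v \<in> tensors \<A> x 1 0"
proof -
  have "a *\<^sub>R \<alpha> + b *\<^sub>R \<beta> \<in> cotangent_space \<A> x"
    if "\<alpha> \<in> cotangent_space \<A> x" "\<beta> \<in> cotangent_space \<A> x" for \<alpha> \<beta> a b
    using assms that by (intro subspace_add subspace_scale)
  then show ?thesis
    unfolding tensors_def tensor_args_def vector_tensor_def
    by (auto simp: length_Suc_conv) (auto simp: scaleR_fun_def)
qed

lemma covector_tensor_in_tensors:
  assumes "subspace (tangent_space \<A> x)" and "\<omega> \<in> cotangent_space \<A> x"
  shows "covector_tensor \<A> x \<omega> \<in> tensors \<A> x 0 1"
  using assms(1) cotangent_space_linear[OF assms(2)]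
  unfolding tensors_def tensor_args_def covector_tensor_def
  by (auto simp: length_Suc_conv subspace_add subspace_scale)

lemma tensor_args_take_drop:
  "(\<omega>s, vs) \<in> tensor_args \<A> x (p + p') (q + q') \<longleftrightarrow>
     (take p \<omega>s, take q vs) \<in> tensor_args \<A> x p q \<and>
     (drop p \<omega>s, drop q vs) \<in> tensor_args \<A> x p' q'"
proof -
  have "set zs = set (take n zs) \<union> set (drop n zs)" for n and zs :: "'z list"
    by (metis append_take_drop_id set_append)
  then have split: "set zs \<subseteq> V \<longleftrightarrow> set (take n zs) \<subseteq> V \<and> set (drop n zs) \<subseteq> V"
    for n V and zs :: "'z list"
    by (metis le_sup_iff)
  show ?thesis
    unfolding tensor_args_def
    by (auto simp: split[of \<omega>s "cotangent_space \<A> x" p] split[of vs "tangent_space \<A> x" q])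
qed

lemma tensor_prod_in_tensors:
  assumes A: "A \<in> tensors \<A> x p q" and B: "B \<in> tensors \<A> x p' q'"
  shows "tensor_prod p q A B \<in> tensors \<A> x (p + p') (q + q')"
  unfolding tensors_def
proof (safe, goal_cases)
  case (1 \<omega>s vs)
  then show ?case
    using A B unfolding tensor_args_take_drop tensor_prod_def tensors_def by auto
next
  case (2 \<omega>s vs r \<alpha> \<beta> a b)
  then have args: "(take p \<omega>s, take q vs) \<in> tensor_args \<A> x p q"
    "(drop p \<omega>s, drop q vs) \<in> tensor_args \<A> x p' q'"
    by (simp_all add: tensor_args_take_drop)
  show ?case
  proof (cases "r < p")
    case True
    then have "A ((take p \<omega>s)[r := a *\<^sub>R \<alpha> + b *\<^sub>R \<beta>]) (take q vs) =
        a * A ((take p \<omega>s)[r := \<alpha>]) (take q vs) + b * A ((take p \<omega>s)[r := \<beta>]) (take q vs)"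
      using A args(1) 2(3,4) unfolding tensors_def by blast
    then show ?thesis
      using True by (simp add: tensor_prod_def take_update_swap algebra_simps)
  next
    case False
    then have "r - p < p'" using 2(2) by simp
    then have "B ((drop p \<omega>s)[r - p := a *\<^sub>R \<alpha> + b *\<^sub>R \<beta>]) (drop q vs) =
        a * B ((drop p \<omega>s)[r - p := \<alpha>]) (drop q vs) + b * B ((drop p \<omega>s)[r - p := \<beta>]) (drop q vs)"
      using B args(2) 2(3,4) unfolding tensors_def by blast
    then show ?thesis
      using False by (simp add: tensor_prod_def drop_update_swap algebra_simps)
  qed
next
  case (3 \<omega>s vs s u w a b)
  then have args: "(take p \<omega>s, take q vs) \<in> tensor_args \<A> x p q"
    "(drop p \<omega>s, drop q vs) \<in> tensor_args \<A> x p' q'"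
    by (simp_all add: tensor_args_take_drop)
  show ?case
  proof (cases "s < q")
    case True
    then have "A (take p \<omega>s) ((take q vs)[s := a *\<^sub>R u + b *\<^sub>R w]) =
        a * A (take p \<omega>s) ((take q vs)[s := u]) + b * A (take p \<omega>s) ((take q vs)[s := w])"
      using A args(1) 3(3,4) unfolding tensors_def by blast
    then show ?thesis
      using True by (simp add: tensor_prod_def take_update_swap algebra_simps)
  next
    case False
    then have "s - q < q'" using 3(2) by simp
    then have "B (drop p \<omega>s) ((drop q vs)[s - q := a *\<^sub>R u + b *\<^sub>R w]) =
        a * B (drop p \<omega>s) ((drop q vs)[s - q := u]) + b * B (drop p \<omega>s) ((drop q vs)[s - q := w])"
      using B args(2) 3(3,4) unfolding tensors_def by blast
    then show ?thesis
      using False by (simp add: tensor_prod_def drop_update_swap algebra_simps)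
  qed
qed

text \<open>The type of the last factor \<open>S\<close> is left open, so that an iterated product of covectors can
  serve as the last factor of an iterated product of vectors.\<close>

lemma foldr_tensor_prod_in_tensors:
  assumes "\<And>j. j \<in> set js \<Longrightarrow> A j \<in> tensors \<A> x p q" and "S \<in> tensors \<A> x p' q'"
  shows "foldr (\<lambda>j. tensor_prod p q (A j)) js S \<in>
    tensors \<A> x (length js * p + p') (length js * q + q')"
  using assms
proof (induction js)
  case (Cons j js)
  then show ?case
    using tensor_prod_in_tensors[of "A j" \<A> x p q] by (simp add: add.assoc)
qed simp

section \<open>Multiplying out iterated tensor products\<close>

lemma tensor_prod_sum_left:
  "tensor_prod p q (\<Sum>i\<in>I. a i *\<^sub>R A i) B = (\<Sum>i\<in>I. a i *\<^sub>R tensor_prod p q (A i) B)"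
  by (simp add: tensor_prod_def fun_eq_iff sum_fun_apply scaleR_fun_def sum_distrib_right mult.assoc)

lemma tensor_prod_sum_right:
  "tensor_prod p q A (\<Sum>i\<in>I. b i *\<^sub>R B i) = (\<Sum>i\<in>I. b i *\<^sub>R tensor_prod p q A (B i))"
  by (simp add: tensor_prod_def fun_eq_iff sum_fun_apply scaleR_fun_def sum_distrib_left
      mult.left_commute)

lemma foldr_tensor_prod_sum_right:
  "foldr (\<lambda>j. tensor_prod p q (A j)) js (\<Sum>i\<in>I. b i *\<^sub>R B i) =
    (\<Sum>i\<in>I. b i *\<^sub>R foldr (\<lambda>j. tensor_prod p q (A j)) js (B i))"
  by (induction js) (simp_all add: tensor_prod_sum_right)

lemma sum_lists_Suc:
  fixes f :: "'n::finite list \<Rightarrow> 'b::comm_monoid_add"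
  shows "(\<Sum>ks | length ks = Suc n. f ks) = (\<Sum>k\<in>UNIV. \<Sum>ks | length ks = n. f (k # ks))"
proof -
  have "bij_betw (\<lambda>(k, ks). k # ks) (UNIV \<times> {ks. length ks = n}) {ks::'n list. length ks = Suc n}"
    by (auto simp: bij_betw_def inj_on_def length_Suc_conv)
  from sum.reindex_bij_betw[OF this, of f] show ?thesis
    by (simp add: sum.cartesian_product case_prod_unfold)
qed

text \<open>The distributive law: a summand of the product of the sums arises by choosing from the
  \<open>b\<close>-th factor the summand with index \<open>ls ! b\<close>.\<close>

lemma foldr_tensor_prod_sum:
  fixes D :: "'n::finite \<Rightarrow> ('m, 'k) tensor"
  shows "foldr (\<lambda>j. tensor_prod p q (\<Sum>i\<in>UNIV. h i j *\<^sub>R D i)) js S =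
    (\<Sum>ls | length ls = length js.
      (\<Prod>b<length js. h (ls ! b) (js ! b)) *\<^sub>R foldr (\<lambda>i. tensor_prod p q (D i)) ls S)"
proof (induction js)
  case (Cons j js)
  let ?P = "\<lambda>ls. foldr (\<lambda>i. tensor_prod p q (D i)) ls S"
  have "foldr (\<lambda>j. tensor_prod p q (\<Sum>i\<in>UNIV. h i j *\<^sub>R D i)) (j # js) S =
      tensor_prod p q (\<Sum>i\<in>UNIV. h i j *\<^sub>R D i)
        (\<Sum>ls | length ls = length js. (\<Prod>b<length js. h (ls ! b) (js ! b)) *\<^sub>R ?P ls)"
    by (simp only: foldr.simps comp_apply Cons.IH)
  also have "\<dots> = (\<Sum>i\<in>UNIV. h i j *\<^sub>R (\<Sum>ls | length ls = length js.
      (\<Prod>b<length js. h (ls ! b) (js ! b)) *\<^sub>R tensor_prod p q (D i) (?P ls)))"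
    unfolding tensor_prod_sum_left by (simp only: tensor_prod_sum_right)
  also have "\<dots> = (\<Sum>ls | length ls = length (j # js).
      (\<Prod>b<length (j # js). h (ls ! b) ((j # js) ! b)) *\<^sub>R ?P ls)"
    by (simp only: foldr.simps comp_apply length_Cons sum_lists_Suc prod.lessThan_Suc_shift
        nth_Cons_0 nth_Cons_Suc scaleR_sum_right scaleR_scaleR)
  finally show ?case .
qed simp

section \<open>Flat linear transports on iterated products\<close>

lemma transport_in_tensors:
  assumes "flat_linear_transport M \<A> L" "x \<in> topspace M" "y \<in> topspace M" "A \<in> tensors \<A> x p q"
  shows "L x y A \<in> tensors \<A> y p q"
  using assms(1)[unfolded flat_linear_transport_def, THEN conjunct1] assms(2-) by blast

lemma transport_linear:
  assumes "flat_linear_transport M \<A> L" "x \<in> topspace M" "y \<in> topspace M"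
    and "A \<in> tensors \<A> x p q" "B \<in> tensors \<A> x p q"
  shows "L x y (a *\<^sub>R A + b *\<^sub>R B) = a *\<^sub>R L x y A + b *\<^sub>R L x y B"
  using assms(1)[unfolded flat_linear_transport_def, THEN conjunct2, THEN conjunct1] assms(2-)
  by blast

lemma transport_tensor_prod:
  assumes "flat_linear_transport M \<A> L" "x \<in> topspace M" "y \<in> topspace M"
    and "A \<in> tensors \<A> x p q" "B \<in> tensors \<A> x p' q'"
  shows "L x y (tensor_prod p q A B) = tensor_prod p q (L x y A) (L x y B)"
  using assms(1)[unfolded flat_linear_transport_def, THEN conjunct2, THEN conjunct2, THEN conjunct1]
    assms(2-)
  by blast

lemma transport_inverse:
  assumes "flat_linear_transport M \<A> L" "x \<in> topspace M" "y \<in> topspace M" "A \<in> tensors \<A> x p q"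
  shows "L y x (L x y A) = A"
  using assms unfolding flat_linear_transport_def by metis

lemma transport_zero:
  assumes "flat_linear_transport M \<A> L" "x \<in> topspace M" "y \<in> topspace M"
  shows "L x y 0 = 0"
  using transport_linear[OF assms subspace_0 subspace_0, OF subspace_tensors subspace_tensors, of 0 0]
  by simp

lemma transport_sum:
  assumes L: "flat_linear_transport M \<A> L" "x \<in> topspace M" "y \<in> topspace M"
    and A: "\<And>i. i \<in> I \<Longrightarrow> A i \<in> tensors \<A> x p q"
  shows "L x y (\<Sum>i\<in>I. a i *\<^sub>R A i) = (\<Sum>i\<in>I. a i *\<^sub>R L x y (A i))"
  using A
proof (induction I rule: infinite_finite_induct)
  case (insert i I)
  have "(\<Sum>i\<in>I. a i *\<^sub>R A i) \<in> tensors \<A> x p q"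
    using insert by (intro subspace_sum subspace_scale subspace_tensors) auto
  moreover have "A i \<in> tensors \<A> x p q" using insert by blast
  ultimately have "L x y (a i *\<^sub>R A i + 1 *\<^sub>R (\<Sum>i\<in>I. a i *\<^sub>R A i)) =
      a i *\<^sub>R L x y (A i) + 1 *\<^sub>R L x y (\<Sum>i\<in>I. a i *\<^sub>R A i)"
    by (intro transport_linear[OF L])
  moreover have "L x y (\<Sum>i\<in>I. a i *\<^sub>R A i) = (\<Sum>i\<in>I. a i *\<^sub>R L x y (A i))"
    using insert by blast
  ultimately show ?case
    by (simp only: sum.insert[OF insert.hyps] scaleR_one)
qed (simp_all add: transport_zero[OF L])

lemma transport_scalar_one:
  fixes \<A> :: "('m, 'n::finite) chart set"
  assumes L: "flat_linear_transport M \<A> L" "x \<in> topspace M" "y \<in> topspace M"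
  shows "L x y (scalar_tensor 1) = scalar_tensor 1"
proof -
  let ?one = "scalar_tensor 1 :: ('m, 'n) tensor"
  note one = scalar_tensor_in_tensors[of 1 \<A> x]
  obtain c where c: "L x y ?one = scalar_tensor c"
    using transport_in_tensors[OF L one] by (rule tensors_scalarE)
  have scalar_prod: "tensor_prod 0 0 (scalar_tensor a) (scalar_tensor b) = scalar_tensor (a * b)"
    for a b
    by (auto simp: tensor_prod_def scalar_tensor_def fun_eq_iff)
  have "scalar_tensor c = (scalar_tensor (c * c) :: ('m, 'n) tensor)"
    using transport_tensor_prod[OF L one one] by (simp only: scalar_prod c mult_1)
  then have "c = c * c"
    by (simp only: scalar_tensor_eq_iff)
  moreover have "c \<noteq> 0"
  proof
    assume "c = 0"
    then have "L x y ?one = 0"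
      by (simp only: c scalar_tensor_zero)
    then have "?one = scalar_tensor 0"
      using transport_inverse[OF L one] transport_zero[OF L(1,3,2)]
      by (simp only: scalar_tensor_zero)
    then show False
      by (simp only: scalar_tensor_eq_iff one_neq_zero)
  qed
  ultimately show ?thesis using c by simp
qed

lemma transport_foldr_tensor_prod:
  assumes L: "flat_linear_transport M \<A> L" "x \<in> topspace M" "y \<in> topspace M"
    and A: "\<And>j. j \<in> set js \<Longrightarrow> A j \<in> tensors \<A> x p q" and S: "S \<in> tensors \<A> x p' q'"
  shows "L x y (foldr (\<lambda>j. tensor_prod p q (A j)) js S) =
    foldr (\<lambda>j. tensor_prod p q (L x y (A j))) js (L x y S)"
  using A
proof (induction js)
  case (Cons j js)
  have "foldr (\<lambda>j. tensor_prod p q (A j)) js S \<in>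
      tensors \<A> x (length js * p + p') (length js * q + q')"
    using Cons.prems S by (intro foldr_tensor_prod_in_tensors) auto
  then show ?case
    using Cons transport_tensor_prod[OF L, of "A j" p q] by simp
qed simp

lemma tensor_prod_list_in_tensors:
  assumes "subspace (tangent_space \<A> x)" "subspace (cotangent_space \<A> x)"
    and "set \<omega>s \<subseteq> cotangent_space \<A> x"
  shows "tensor_prod_list \<A> x vs \<omega>s \<in> tensors \<A> x (length vs) (length \<omega>s)"
proof -
  have "foldr (\<lambda>\<omega>. tensor_prod 0 1 (covector_tensor \<A> x \<omega>)) \<omega>s (scalar_tensor 1)
      \<in> tensors \<A> x (length \<omega>s * 0 + 0) (length \<omega>s * 1 + 0)"
    using assms
    by (intro foldr_tensor_prod_in_tensors covector_tensor_in_tensors scalar_tensor_in_tensors) auto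
  then have "tensor_prod_list \<A> x vs \<omega>s \<in>
      tensors \<A> x (length vs * 1 + 0) (length vs * 0 + length \<omega>s)"
    unfolding tensor_prod_list_def using assms
    by (intro foldr_tensor_prod_in_tensors vector_tensor_in_tensors) auto
  then show ?thesis by simp
qed

lemma transport_tensor_prod_list:
  assumes L: "flat_linear_transport M \<A> L" "x \<in> topspace M" "y \<in> topspace M"
    and sub: "subspace (tangent_space \<A> x)" "subspace (cotangent_space \<A> x)"
    and \<omega>s: "set \<omega>s \<subseteq> cotangent_space \<A> x"
  shows "L x y (tensor_prod_list \<A> x vs \<omega>s) =
    foldr (\<lambda>v. tensor_prod 1 0 (L x y (vector_tensor \<A> x v))) vs
      (foldr (\<lambda>\<omega>. tensor_prod 0 1 (L x y (covector_tensor \<A> x \<omega>))) \<omega>s (scalar_tensor 1))"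
proof -
  have cov: "covector_tensor \<A> x \<omega> \<in> tensors \<A> x 0 1" if "\<omega> \<in> set \<omega>s" for \<omega>
    using that \<omega>s by (intro covector_tensor_in_tensors sub) auto
  have covs: "foldr (\<lambda>\<omega>. tensor_prod 0 1 (covector_tensor \<A> x \<omega>)) \<omega>s (scalar_tensor 1)
      \<in> tensors \<A> x (length \<omega>s * 0 + 0) (length \<omega>s * 1 + 0)"
    by (intro foldr_tensor_prod_in_tensors cov scalar_tensor_in_tensors)
  have "L x y (tensor_prod_list \<A> x vs \<omega>s) =
      foldr (\<lambda>v. tensor_prod 1 0 (L x y (vector_tensor \<A> x v))) vs
        (L x y (foldr (\<lambda>\<omega>. tensor_prod 0 1 (covector_tensor \<A> x \<omega>)) \<omega>s (scalar_tensor 1)))"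
    unfolding tensor_prod_list_def
    by (rule transport_foldr_tensor_prod[OF L vector_tensor_in_tensors[OF sub(2)] covs])
  also have "L x y (foldr (\<lambda>\<omega>. tensor_prod 0 1 (covector_tensor \<A> x \<omega>)) \<omega>s (scalar_tensor 1)) =
      foldr (\<lambda>\<omega>. tensor_prod 0 1 (L x y (covector_tensor \<A> x \<omega>))) \<omega>s
        (L x y (scalar_tensor 1))"
    by (rule transport_foldr_tensor_prod[OF L cov scalar_tensor_in_tensors])
  finally show ?thesis
    unfolding transport_scalar_one[OF L] .
qed

lemma transport_tensor_prod_list_expand:
  fixes E G :: "'n::finite \<Rightarrow> ('m, 'n) tvec" and F K :: "'n \<Rightarrow> ('m, 'n) covec"
  assumes L: "flat_linear_transport M \<A> L" "x \<in> topspace M" "y \<in> topspace M"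
    and sub: "subspace (tangent_space \<A> x)" "subspace (cotangent_space \<A> x)"
    and F: "\<And>j. F j \<in> cotangent_space \<A> x"
    and h: "\<And>j. L x y (vector_tensor \<A> x (E j)) = (\<Sum>i\<in>UNIV. h i j *\<^sub>R vector_tensor \<A> y (G i))"
    and h': "\<And>j. L x y (covector_tensor \<A> x (F j)) =
      (\<Sum>i\<in>UNIV. h' i j *\<^sub>R covector_tensor \<A> y (K i))"
  shows "L x y (tensor_prod_list \<A> x (map E is) (map F js)) =
    (\<Sum>ks | length ks = length is. \<Sum>ls | length ls = length js.
      ((\<Prod>a<length is. h (ks ! a) (is ! a)) * (\<Prod>b<length js. h' (ls ! b) (js ! b))) *\<^sub>R
        tensor_prod_list \<A> y (map G ks) (map K ls))"
proof -
  have "set (map F js) \<subseteq> cotangent_space \<A> x" using F by auto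
  note transport_tensor_prod_list[OF L sub this, of "map E is"]
  then show ?thesis
    by (simp add: tensor_prod_list_def foldr_map comp_def h h' foldr_tensor_prod_sum
        foldr_tensor_prod_sum_right scaleR_sum_right mult.commute)
      (rule sum.swap)
qed

theorem proposition2p3:
  fixes M :: "'m topology" and \<A> :: "('m, 'n::finite) chart set"
    and L :: "'m \<Rightarrow> 'm \<Rightarrow> ('m, 'n) tensor \<Rightarrow> ('m, 'n) tensor"
    and E :: "'m \<Rightarrow> 'n \<Rightarrow> ('m, 'n) tvec" and F :: "'m \<Rightarrow> 'n \<Rightarrow> ('m, 'n) covec"
    and H :: "'m \<Rightarrow> 'm \<Rightarrow> 'n \<Rightarrow> 'n \<Rightarrow> real"
    and H' :: "'m \<Rightarrow> 'm \<Rightarrow> 'n \<Rightarrow> 'n \<Rightarrow> real"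
    and x y :: 'm and p q :: nat
    and t :: "'n list \<Rightarrow> 'n list \<Rightarrow> real" and T :: "('m, 'n) tensor"
  assumes M: "differentiable_manifold M \<A>"
    and L: "flat_linear_transport M \<A> L"
    and EF: "\<And>x. x \<in> topspace M \<Longrightarrow> dual_bases \<A> x (E x) (F x)"
    and H: "\<And>x y j. x \<in> topspace M \<Longrightarrow> y \<in> topspace M \<Longrightarrow>
      L x y (vector_tensor \<A> x (E x j)) = (\<Sum>i\<in>UNIV. H y x i j *\<^sub>R vector_tensor \<A> y (E y i))"
    and H': "\<And>x y j. x \<in> topspace M \<Longrightarrow> y \<in> topspace M \<Longrightarrow>
      L x y (covector_tensor \<A> x (F x j)) = (\<Sum>i\<in>UNIV. H' y x i j *\<^sub>R covector_tensor \<A> y (F y i))"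
    and x: "x \<in> topspace M" and y: "y \<in> topspace M"
    and T_in: "T \<in> tensors \<A> x p q"
    and T: "T = (\<Sum>is | length is = p. \<Sum>js | length js = q.
      t is js *\<^sub>R tensor_prod_list \<A> x (map (E x) is) (map (F x) js))"
  shows "L x y T = (\<Sum>is | length is = p. \<Sum>js | length js = q.
      \<Sum>ks | length ks = p. \<Sum>ls | length ls = q.
        ((\<Prod>a<p. H y x (ks ! a) (is ! a)) * (\<Prod>b<q. H' y x (ls ! b) (js ! b)) * t is js) *\<^sub>R
          tensor_prod_list \<A> y (map (E y) ks) (map (F y) ls))"
proof -
  note db = dual_bases_subspace[OF EF[OF x]]
  let ?B = "\<lambda>is js. tensor_prod_list \<A> x (map (E x) is) (map (F x) js)"
  have B_in: "?B is js \<in> tensors \<A> x p q" if "length is = p" "length js = q" for "is" js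
  proof -
    have "?B is js \<in> tensors \<A> x (length (map (E x) is)) (length (map (F x) js))"
      using db(4) by (intro tensor_prod_list_in_tensors db) auto
    then show ?thesis using that by simp
  qed
  have inner: "L x y (\<Sum>js | length js = q. t is js *\<^sub>R ?B is js) =
      (\<Sum>js | length js = q. t is js *\<^sub>R L x y (?B is js))" if "length is = p" for "is"
    using that by (intro transport_sum[OF L x y]) (auto intro: B_in)
  (* The coefficients 1 bring the outer sum into the form of a linear combination. *)
  have "L x y (\<Sum>is | length is = p. 1 *\<^sub>R (\<Sum>js | length js = q. t is js *\<^sub>R ?B is js)) =
      (\<Sum>is | length is = p. 1 *\<^sub>R L x y (\<Sum>js | length js = q. t is js *\<^sub>R ?B is js))"
    by (rule transport_sum[OF L x y])
      (auto intro!: subspace_sum subspace_scale subspace_tensors B_in)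
  also have "\<dots> = (\<Sum>is | length is = p. \<Sum>js | length js = q. t is js *\<^sub>R L x y (?B is js))"
    by (simp add: inner)
  also have "\<dots> = (\<Sum>is | length is = p. \<Sum>js | length js = q.
      \<Sum>ks | length ks = p. \<Sum>ls | length ls = q.
        ((\<Prod>a<p. H y x (ks ! a) (is ! a)) * (\<Prod>b<q. H' y x (ls ! b) (js ! b)) * t is js) *\<^sub>R
          tensor_prod_list \<A> y (map (E y) ks) (map (F y) ls))"
    by (simp add: transport_tensor_prod_list_expand[OF L x y db(1,2,4) H[OF x y] H'[OF x y]]
        scaleR_sum_right mult.commute)
  finally show ?thesis by (simp add: T)
qed

end
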